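(* Let $n\geq 2$ and let $G\subset\mathbb{R}^n$ be an unbounded open convex set that does not contain a translation of a cone with non-empty interior. Let $\omega\in\mathcal{M}$ be concave and satisfy $$\inf_{k\in\mathbb{N}}\left(\liminf_{h\to\infty}\frac{\omega(h)}{k\,\omega\left(\frac{h}{k}\right)}\right)=0 .$$ Then there exists $f:G\to\mathbb{R}$ that is both $\omega$-semiconvex and $\omega$-semiconcave and such that $f\notin C^{1,\omega}(G)$.
   Context: The norm $|\cdot|$ on $\mathbb{R}^n$ is Euclidean; $\mathbb{N}$ is the set of positive integers. A cone in $\mathbb{R}^n$ is a set $C\subset\mathbb{R}^n$ such that $\lambda x\in C$ for each $x\in C$ and $\lambda>0$. $\mathcal{M}$ denotes the set of all non-decreasing $\omega:[0,\infty)\to[0,\infty)$ with $\lim_{h\to 0+}\omega(h)=0$ (moduli). The displayed infimum condition on $\omega$ presupposes that the quotients in it are well defined for large $h$; in particular $\omega$ is not identically zero. Let $G\subset\mathbb{R}^n$ be open and convex and $\omega\in\mathcal{M}$. A function $f:G\to\mathbb{R}$ is $\omega$-semiconvex if $$f(\lambda x+(1-\lambda)y)\leq\lambda f(x)+(1-\lambda)f(y)+\lambda(1-\lambda)|x-y|\,\omega(|x-y|)$$ for every $x,y\in G$ and $\lambda\in[0,1]$. It is $\omega$-semiconcave if $-f$ is $\omega$-semiconvex. $C^{1,\omega}(G)$ is the set of all Fréchet differentiable $f:G\to\mathbb{R}$ for which there is $C>0$ with $|f'(x)-f'(y)|\leq C\omega(|x-y|)$ for all $x,y\in G$, where $f'(x)$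 is the Fréchet derivative of $f$ at $x$. *)

theory Defs
  imports "HOL-Analysis.Analysis"
begin

(* The library's "cone" requires closure under all c >= 0, hence a non-empty one contains 0. *)
definition pos_cone :: "'a::real_vector set \<Rightarrow> bool" where
  "pos_cone C \<longleftrightarrow> (\<forall>x\<in>C. \<forall>l>0. l *\<^sub>R x \<in> C)"

(* A function on [0,oo) is a total function of which only the values on {0..} matter. *)
definition modulus :: "(real \<Rightarrow> real) \<Rightarrow> bool" where
  "modulus \<omega> \<longleftrightarrow> (\<forall>h\<ge>0. 0 \<le> \<omega> h) \<and> mono_on {0..} \<omega> \<and> (\<omega> \<longlongrightarrow> 0) (at_right 0)"

definition semiconvex_on :: "'a::real_normed_vector set \<Rightarrow> (real \<Rightarrow> real) \<Rightarrow> ('a \<Rightarrow> real) \<Rightarrow> bool" where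
  "semiconvex_on G \<omega> f \<longleftrightarrow>
     (\<forall>x\<in>G. \<forall>y\<in>G. \<forall>l\<in>{0..1}.
        f (l *\<^sub>R x + (1 - l) *\<^sub>R y)
          \<le> l * f x + (1 - l) * f y + l * (1 - l) * norm (x - y) * \<omega> (norm (x - y)))"

definition semiconcave_on :: "'a::real_normed_vector set \<Rightarrow> (real \<Rightarrow> real) \<Rightarrow> ('a \<Rightarrow> real) \<Rightarrow> bool" where
  "semiconcave_on G \<omega> f \<longleftrightarrow> semiconvex_on G \<omega> (\<lambda>x. - f x)"

(* Intended for open G: then the derivative at a point of G does not depend on the values
   of f outside G. *)
definition C1_modulus :: "'a::real_normed_vector set \<Rightarrow> (real \<Rightarrow> real) \<Rightarrow> ('a \<Rightarrow> real) set" where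
  "C1_modulus G \<omega> =
     {f. (\<forall>x\<in>G. f differentiable (at x)) \<and>
         (\<exists>C>0. \<forall>x\<in>G. \<forall>y\<in>G.
            onorm (\<lambda>v. frechet_derivative f (at x) v - frechet_derivative f (at y) v)
              \<le> C * \<omega> (norm (x - y)))}"

end

theory Submission imports Defs begin

text \<open>
  Translate \<open>G\<close> so that \<open>0 \<in> G\<close>. The directions of the rays from \<open>0\<close> that stay in \<open>G\<close> form a
  convex cone contained in \<open>G\<close>; it has empty interior, so it lies in a hyperplane with some unit
  normal \<open>e\<close>. By compactness of the sphere, \<open>\<bar>x \<bullet> e\<bar> = o(norm x)\<close> on \<open>G\<close>: seen from far away,
  \<open>G\<close> is flat in the direction \<open>e\<close> (\<open>flat_direction\<close>). As \<open>G\<close> is unbounded, it also contains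
  a ray in a unit direction \<open>d\<close>, and \<open>d \<bullet> e = 0\<close>.

  Flatness is exploited as follows. Semiconvexity and semiconcavity together follow from
  \<open>\<bar>(f'(a) - f'(b)) (a - b)\<bar> \<le> C * norm (a - b) * \<omega> (norm (a - b))\<close>, which tests the variation of
  the derivative between \<open>a\<close> and \<open>b\<close> only in the direction \<open>a - b\<close> (\<open>convexity_defect_le\<close>).
  Two points of \<open>G\<close> at a large distance are
  nearly aligned with the hyperplane, so the derivative in the direction \<open>e\<close> may vary along \<open>G\<close>
  by more than \<open>\<omega>\<close> allows. The building block is \<open>(x \<bullet> e) * saturation (x / h)\<close>, where
  \<open>saturation y = (norm y)\<^sup>2 / (1 + (norm y)\<^sup>2)\<close>: along the ray its derivative in the direction \<open>e\<close> rises
  from \<open>0\<close> at the origin to \<open>1/2\<close> at distance \<open>h\<close>. If \<open>\<bar>x \<bullet> e\<bar> \<le> (norm x + h) / k\<close> on \<open>G\<close>, then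
  the multiple by \<open>k * \<omega> (h / k)\<close> is semiconvex and semiconcave with a constant independent of
  \<open>h\<close> and \<open>k\<close> (\<open>scaled_tilt_defect\<close>), whereas its derivative varies by \<open>k * \<omega> (h / k) / 2\<close>
  between \<open>0\<close> and \<open>h d\<close>. The hypothesis on the infimum says that, for every \<open>\<epsilon> > 0\<close>, some \<open>k\<close>
  and arbitrarily large \<open>h\<close> satisfy \<open>\<omega> h \<le> \<epsilon> * k * \<omega> (h / k)\<close> (\<open>good_scales\<close>).

  Finally such blocks are summed with weights \<open>2^-j\<close>, at scales where
  \<open>\<omega> (h\<^sub>j) \<le> 4^-j * k\<^sub>j * \<omega> (h\<^sub>j / k\<^sub>j)\<close> (\<open>steep_flat_function\<close>). Nothing cancels, because every
  \<open>saturation\<close> is radially increasing: comparing the derivatives in the direction \<open>e\<close> at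
  \<open>h\<^sub>j d\<close> and \<open>0\<close>, the other blocks only help the \<open>j\<close>-th one. The defect estimate passes to the sum
  pointwise, so the sum never has to be differentiated.
\<close>

section \<open>A bounded radially increasing weight\<close>

definition saturation :: "'a::real_inner \<Rightarrow> real" where
  "saturation y = (y \<bullet> y) / (1 + y \<bullet> y)"

lemma saturation_altdef: "saturation y = 1 - 1 / (1 + y \<bullet> y)"
proof -
  have "1 + y \<bullet> y > 0" using inner_ge_zero[of y] by linarith
  thus ?thesis by (simp add: saturation_def field_simps)
qed

lemma saturation_mono:
  assumes "norm x \<le> norm y"
  shows "saturation x \<le> saturation y"
proof -
  have "x \<bullet> x \<le> y \<bullet> y" using assms by (simp add: dot_square_norm power_mono)
  moreover have "0 \<le> x \<bullet> x" by simp
  ultimately have "1 / (1 + y \<bullet> y) \<le> 1 / (1 + x \<bullet> x)" by (intro divide_left_mono mult_pos_pos add_pos_nonneg) auto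
  thus ?thesis by (simp add: saturation_altdef)
qed

lemma saturation_nonneg: "0 \<le> saturation y"
  by (simp add: saturation_def)

lemma saturation_le: "saturation y \<le> (norm y)\<^sup>2"
proof -
  have "(y \<bullet> y) / (1 + y \<bullet> y) \<le> (y \<bullet> y) / 1" by (intro divide_left_mono) (auto intro: add_pos_nonneg)
  thus ?thesis by (simp add: saturation_def dot_square_norm)
qed

section \<open>The building block and its derivative\<close>

text \<open>
  Since \<open>saturation\<close> tends to \<open>1\<close> at infinity, this function bends from \<open>0\<close> near the origin into
  the linear function \<open>y \<bullet> e\<close> far away; the transition takes place around the unit sphere.
\<close>

definition tilt :: "'a::real_inner \<Rightarrow> 'a \<Rightarrow> real" where
  "tilt e y = (y \<bullet> e) * saturation y"

definition tilt_deriv :: "'a::real_inner \<Rightarrow> 'a \<Rightarrow> 'a \<Rightarrow> real" where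
  "tilt_deriv e a v = (v \<bullet> e) * saturation a + (a \<bullet> e) * (2 * (a \<bullet> v)) / (1 + a \<bullet> a)\<^sup>2"

lemma tilt_has_derivative: "(tilt e has_derivative tilt_deriv e a) (at a)"
proof -
  have p: "1 + a \<bullet> a \<noteq> 0" using inner_ge_zero[of a] by linarith
  have "((\<lambda>y. (y \<bullet> e) * (1 - 1 / (1 + y \<bullet> y))) has_derivative tilt_deriv e a) (at a)"
    unfolding tilt_deriv_def saturation_altdef
    using p by (auto intro!: derivative_eq_intros simp: inner_commute power2_eq_square)
  moreover have "tilt e = (\<lambda>y. (y \<bullet> e) * (1 - 1 / (1 + y \<bullet> y)))"
    by (simp add: fun_eq_iff tilt_def saturation_altdef)
  ultimately show ?thesis by simp
qed

lemma saturation_diff: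
  "\<bar>saturation a - saturation b\<bar>
     \<le> norm (a - b) * (norm a + norm b) / ((1 + (norm a)\<^sup>2) * (1 + (norm b)\<^sup>2))"
proof -
  define A B where "A = norm a" and "B = norm b"
  have p: "1 + A\<^sup>2 > 0" "1 + B\<^sup>2 > 0" by (auto intro: add_pos_nonneg)
  have AB: "A \<ge> 0" "B \<ge> 0" by (auto simp: A_def B_def)
  have e: "saturation a - saturation b = (A - B) * (A + B) / ((1 + A\<^sup>2) * (1 + B\<^sup>2))"
    using p unfolding saturation_altdef dot_square_norm A_def[symmetric] B_def[symmetric]
    by (simp add: field_simps power2_eq_square)
  have "\<bar>A - B\<bar> \<le> norm (a - b)" unfolding A_def B_def by (rule norm_triangle_ineq3)
  hence "\<bar>(A - B) * (A + B)\<bar> \<le> norm (a - b) * (A + B)"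
    using AB by (simp add: abs_mult mult_right_mono)
  thus ?thesis using p unfolding e A_def[symmetric] B_def[symmetric]
    by (simp add: abs_mult divide_right_mono)
qed

text \<open>
  The gain of \<open>1 / k\<close> comes from \<open>\<bar>(a - b) \<bullet> e\<bar>\<close>, \<open>\<bar>a \<bullet> e\<bar>\<close> and \<open>\<bar>b \<bullet> e\<bar>\<close> all being small. They may
  grow with \<open>norm a\<close> and \<open>norm b\<close>, but the quadratic denominators of \<open>saturation\<close> and of its
  gradient absorb that growth.
\<close>

lemma tilt_deriv_far:
  assumes k: "k > 0"
    and a: "\<bar>a \<bullet> e\<bar> \<le> (norm a + 1) / k" and b: "\<bar>b \<bullet> e\<bar> \<le> (norm b + 1) / k"
    and v: "v = a - b"
  shows "\<bar>tilt_deriv e a v - tilt_deriv e b v\<bar> \<le> 9 * norm v / k"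
proof -
  define A B N where "A = norm a" and "B = norm b" and "N = norm v"
  have p: "1 + A\<^sup>2 > 0" "1 + B\<^sup>2 > 0" by (auto intro: add_pos_nonneg)
  have nn: "A \<ge> 0" "B \<ge> 0" "N \<ge> 0" by (auto simp: A_def B_def N_def)
  have ve: "\<bar>v \<bullet> e\<bar> \<le> (A + B + 2) / k"
  proof -
    have "\<bar>v \<bullet> e\<bar> \<le> \<bar>a \<bullet> e\<bar> + \<bar>b \<bullet> e\<bar>" unfolding v inner_diff_left by linarith
    also have "\<dots> \<le> (A + 1) / k + (B + 1) / k" using a b unfolding A_def B_def by linarith
    finally show ?thesis by (simp add: add_divide_distrib)
  qed
  have 1: "\<bar>(v \<bullet> e) * (saturation a - saturation b)\<bar> \<le> 3 * N / k"
  proof -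
    have "2 * A \<le> 1 + A\<^sup>2" "2 * B \<le> 1 + B\<^sup>2" "2 * A * B \<le> A\<^sup>2 + B\<^sup>2"
      using sum_squares_bound[of A 1] sum_squares_bound[of B 1] sum_squares_bound[of A B] by auto
    hence "(A + B + 2) * (A + B) \<le> 3 * ((1 + A\<^sup>2) * (1 + B\<^sup>2))"
      using zero_le_power2[of "A * B"] by (simp add: algebra_simps power2_eq_square)
    hence q: "(A + B + 2) * (A + B) / ((1 + A\<^sup>2) * (1 + B\<^sup>2)) \<le> 3"
      using p by (simp add: pos_divide_le_eq)
    have "\<bar>(v \<bullet> e) * (saturation a - saturation b)\<bar>
        \<le> ((A + B + 2) / k) * (N * (A + B) / ((1 + A\<^sup>2) * (1 + B\<^sup>2)))"
      unfolding abs_mult using saturation_diff[of a b] ve nn k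
      by (intro mult_mono) (auto simp: A_def B_def N_def v)
    also have "\<dots> = (N / k) * ((A + B + 2) * (A + B) / ((1 + A\<^sup>2) * (1 + B\<^sup>2)))" by simp
    also have "\<dots> \<le> (N / k) * 3" using q nn k by (intro mult_left_mono) auto
    finally show ?thesis by (simp add: mult.commute)
  qed
  have 2: "\<bar>(c \<bullet> e) * (2 * (c \<bullet> v)) / (1 + c \<bullet> c)\<^sup>2\<bar> \<le> 3 * N / k"
    if c: "\<bar>c \<bullet> e\<bar> \<le> (norm c + 1) / k" for c
  proof -
    define R where "R = norm c"
    have R: "R \<ge> 0" by (simp add: R_def)
    have P: "1 + R\<^sup>2 \<ge> 1" by simp
    have "2 * R \<le> 1 + R\<^sup>2" using sum_squares_bound[of R 1] by auto
    hence "(R + 1) * (2 * R) \<le> 3 * (1 + R\<^sup>2)" by (simp add: algebra_simps power2_eq_square)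
    also have "1 + R\<^sup>2 \<le> (1 + R\<^sup>2)\<^sup>2" using P by (rule self_le_power) simp
    finally have "(R + 1) * (2 * R) \<le> 3 * (1 + R\<^sup>2)\<^sup>2" by simp
    moreover have "0 < (1 + R\<^sup>2)\<^sup>2" using P by (intro zero_less_power) linarith
    ultimately have q: "(R + 1) * (2 * R) / (1 + R\<^sup>2)\<^sup>2 \<le> 3" by (simp only: pos_divide_le_eq)
    have "\<bar>(c \<bullet> e) * (2 * (c \<bullet> v))\<bar> \<le> ((R + 1) / k) * (2 * (R * N))"
      unfolding abs_mult using c Cauchy_Schwarz_ineq2[of c v] k R
      by (intro mult_mono) (auto simp: R_def N_def)
    hence "\<bar>(c \<bullet> e) * (2 * (c \<bullet> v))\<bar> / (1 + R\<^sup>2)\<^sup>2 \<le> ((R + 1) / k) * (2 * (R * N)) / (1 + R\<^sup>2)\<^sup>2"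
      by (rule divide_right_mono) simp
    hence "\<bar>(c \<bullet> e) * (2 * (c \<bullet> v)) / (1 + c \<bullet> c)\<^sup>2\<bar> \<le> ((R + 1) / k) * (2 * (R * N)) / (1 + R\<^sup>2)\<^sup>2"
      by (simp only: abs_divide abs_power2 abs_of_nonneg dot_square_norm R_def zero_le_power2)
    also have "\<dots> = (N / k) * ((R + 1) * (2 * R) / (1 + R\<^sup>2)\<^sup>2)" by simp
    also have "\<dots> \<le> (N / k) * 3" using q nn k by (intro mult_left_mono) auto
    finally show ?thesis by (simp add: mult.commute)
  qed
  have split: "tilt_deriv e a v - tilt_deriv e b v = (v \<bullet> e) * (saturation a - saturation b)
      + ((a \<bullet> e) * (2 * (a \<bullet> v)) / (1 + a \<bullet> a)\<^sup>2 - (b \<bullet> e) * (2 * (b \<bullet> v)) / (1 + b \<bullet> b)\<^sup>2)"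
    (is "_ = ?T1 + (?T2 - ?T3)") by (simp add: tilt_deriv_def algebra_simps)
  have sum_le: "\<bar>t1 + (t2 - t3)\<bar> \<le> c1 + c2 + c3"
    if "\<bar>t1\<bar> \<le> c1" "\<bar>t2\<bar> \<le> c2" "\<bar>t3\<bar> \<le> c3" for t1 t2 t3 c1 c2 c3 :: real
    using that by linarith
  have "\<bar>tilt_deriv e a v - tilt_deriv e b v\<bar> \<le> 3 * N / k + 3 * N / k + 3 * N / k"
    unfolding split by (rule sum_le[OF 1 2[OF a] 2[OF b]])
  thus ?thesis by (simp add: N_def)
qed

text \<open>
  For points close to each other: the derivative is globally Lipschitz when paired with \<open>a - b\<close>.
  The variation of \<open>(x \<bullet> e) *\<^sub>R \<nabla>saturation x\<close> is split so that the
  factor \<open>b \<bullet> e\<close>, not \<open>a \<bullet> e\<close>, multiplies the difference of the two gradients. As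
  \<open>norm b \<le> norm a\<close>, this factor is dominated by both denominators.
\<close>

lemma tilt_deriv_near_ordered:
  assumes e: "norm e = 1" and le: "norm b \<le> norm a"
  shows "\<bar>tilt_deriv e a (a - b) - tilt_deriv e b (a - b)\<bar> \<le> 7 * (norm (a - b))\<^sup>2"
proof -
  define v A B N P Q where "v = a - b" and "A = norm a" and "B = norm b" and "N = norm v"
    and "P = 1 + A\<^sup>2" and "Q = 1 + B\<^sup>2"
  have nn: "A \<ge> 0" "B \<ge> 0" "N \<ge> 0" "B \<le> A" using le by (auto simp: A_def B_def N_def)
  have PQ: "P \<ge> 1" "Q \<ge> 1" by (auto simp: P_def Q_def)
  hence PQ1: "P * Q \<ge> 1" using mult_mono[of 1 P 1 Q] by simp
  have A2: "2 * A \<le> P" using sum_squares_bound[of A 1] by (simp add: P_def)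
  have B2: "2 * B \<le> Q" using sum_squares_bound[of B 1] by (simp add: Q_def)
  have PP: "P \<le> P\<^sup>2" using PQ(1) by (rule self_le_power) simp
  have N_diff: "A - B \<le> N" unfolding A_def B_def N_def v_def by (rule norm_triangle_ineq2)
  have ve: "\<bar>v \<bullet> e\<bar> \<le> N" using Cauchy_Schwarz_ineq2[of v e] e by (simp add: N_def)
  have be: "\<bar>b \<bullet> e\<bar> \<le> B" using Cauchy_Schwarz_ineq2[of b e] e by (simp add: B_def)
  have 1: "\<bar>(v \<bullet> e) * (saturation a - saturation b)\<bar> \<le> N\<^sup>2"
  proof -
    have "A + B \<le> P * Q"
    proof -
      have "0 \<le> (P - 1) * (Q - 1)" using PQ by simp
      hence "P + Q - 1 \<le> P * Q" by (simp add: algebra_simps)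
      thus ?thesis using A2 B2 PQ by linarith
    qed
    hence q: "(A + B) / (P * Q) \<le> 1" using PQ1 by simp
    have "\<bar>saturation a - saturation b\<bar> \<le> N * ((A + B) / (P * Q))"
      using saturation_diff[of a b] by (simp add: A_def B_def N_def P_def Q_def v_def)
    also have "\<dots> \<le> N * 1" using q nn by (intro mult_left_mono) auto
    finally show ?thesis unfolding abs_mult power2_eq_square using ve nn
      by (intro mult_mono) auto
  qed
  have 2: "\<bar>(v \<bullet> e) * (2 * (a \<bullet> v) / P\<^sup>2)\<bar> \<le> N\<^sup>2"
  proof -
    have "\<bar>2 * (a \<bullet> v) / P\<^sup>2\<bar> \<le> 2 * (A * N) / P\<^sup>2"
      using Cauchy_Schwarz_ineq2[of a v] PQ
      by (simp add: abs_mult divide_right_mono A_def N_def)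
    also have "\<dots> = N * (2 * A / P\<^sup>2)" by simp
    also have "\<dots> \<le> N * 1" using A2 PP PQ nn by (intro mult_left_mono) (auto simp: divide_le_eq_1)
    finally show ?thesis unfolding abs_mult[of "v \<bullet> e"] power2_eq_square using ve nn
      by (intro mult_mono) auto
  qed
  have 3: "\<bar>(b \<bullet> e) * (2 * N\<^sup>2 / P\<^sup>2)\<bar> \<le> N\<^sup>2"
  proof -
    have "\<bar>(b \<bullet> e) * (2 * N\<^sup>2 / P\<^sup>2)\<bar> \<le> B * (2 * N\<^sup>2 / P\<^sup>2)"
      unfolding abs_mult[of "b \<bullet> e"] using be mult_right_mono[OF be, of "2 * N\<^sup>2 / P\<^sup>2"] by simp
    also have "\<dots> = N\<^sup>2 * (2 * B / P\<^sup>2)" by simp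
    also have "\<dots> \<le> N\<^sup>2 * 1" using A2 PP PQ nn
      by (intro mult_left_mono) (auto simp: divide_le_eq_1)
    finally show ?thesis by simp
  qed
  have 4: "\<bar>(b \<bullet> e) * (2 * (b \<bullet> v) * (1 / Q\<^sup>2 - 1 / P\<^sup>2))\<bar> \<le> 4 * N\<^sup>2"
  proof -
    have QP: "Q \<le> P" using nn by (simp add: P_def Q_def power_mono)
    have s: "1 / Q\<^sup>2 - 1 / P\<^sup>2 = (P - Q) * (P + Q) / (P\<^sup>2 * Q\<^sup>2)"
      using PQ by (simp add: field_simps power2_eq_square)
    have s0: "0 \<le> 1 / Q\<^sup>2 - 1 / P\<^sup>2" unfolding s using PQ QP by simp
    have "P - Q = (A - B) * (A + B)" by (simp add: P_def Q_def algebra_simps power2_eq_square)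
    also have "\<dots> \<le> N * (2 * A)" using N_diff nn by (intro mult_mono) auto
    also have "\<dots> \<le> N * P" using A2 nn by (intro mult_left_mono) auto
    finally have "(P - Q) * (P + Q) \<le> (N * P) * (2 * P)" using QP PQ nn by (intro mult_mono) auto
    hence "(P - Q) * (P + Q) / (P\<^sup>2 * Q\<^sup>2) \<le> (N * P) * (2 * P) / (P\<^sup>2 * Q\<^sup>2)"
      using PQ by (intro divide_right_mono) auto
    also have "\<dots> = 2 * N / Q\<^sup>2" using PQ by (simp add: field_simps power2_eq_square)
    finally have s1: "1 / Q\<^sup>2 - 1 / P\<^sup>2 \<le> 2 * N / Q\<^sup>2" unfolding s .
    have "\<bar>(b \<bullet> e) * (2 * (b \<bullet> v) * (1 / Q\<^sup>2 - 1 / P\<^sup>2))\<bar>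
        = \<bar>b \<bullet> e\<bar> * (2 * \<bar>b \<bullet> v\<bar> * (1 / Q\<^sup>2 - 1 / P\<^sup>2))"
      using s0 by (simp add: abs_mult)
    also have "\<dots> \<le> B * (2 * (B * N) * (2 * N / Q\<^sup>2))"
      using be s0 s1 nn Cauchy_Schwarz_ineq2[of b v]
      by (intro mult_mono mult_nonneg_nonneg) (auto simp: B_def N_def)
    also have "\<dots> = 4 * N\<^sup>2 * (B\<^sup>2 / Q\<^sup>2)" by (simp add: power2_eq_square)
    also have "\<dots> \<le> 4 * N\<^sup>2 * 1"
    proof (intro mult_left_mono)
      have "B\<^sup>2 \<le> Q\<^sup>2" using B2 PQ nn by (intro power_mono) auto
      thus "B\<^sup>2 / Q\<^sup>2 \<le> 1" using PQ by simp
    qed simp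
    finally show ?thesis by simp
  qed
  have vv: "a \<bullet> v = b \<bullet> v + N\<^sup>2"
    by (simp add: v_def N_def power2_norm_eq_inner inner_diff_left inner_diff_right inner_commute)
  have ae: "a \<bullet> e = v \<bullet> e + b \<bullet> e" by (simp add: v_def inner_diff_left)
  have PA: "1 + a \<bullet> a = P" "1 + b \<bullet> b = Q"
    by (simp_all add: P_def Q_def A_def B_def power2_norm_eq_inner)
  have split: "tilt_deriv e a v - tilt_deriv e b v = (v \<bullet> e) * (saturation a - saturation b)
      + ((v \<bullet> e) * (2 * (a \<bullet> v) / P\<^sup>2) + ((b \<bullet> e) * (2 * N\<^sup>2 / P\<^sup>2)
        - (b \<bullet> e) * (2 * (b \<bullet> v) * (1 / Q\<^sup>2 - 1 / P\<^sup>2))))"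
    (is "_ = ?T1 + (?T2 + (?T3 - ?T4))")
    unfolding tilt_deriv_def PA ae vv divide_inverse by (simp only: algebra_simps mult_1_left)
  have sum_le: "\<bar>t1 + (t2 + (t3 - t4))\<bar> \<le> c1 + c2 + c3 + c4"
    if "\<bar>t1\<bar> \<le> c1" "\<bar>t2\<bar> \<le> c2" "\<bar>t3\<bar> \<le> c3" "\<bar>t4\<bar> \<le> c4" for t1 t2 t3 t4 c1 c2 c3 c4 :: real
    using that by linarith
  have "\<bar>tilt_deriv e a v - tilt_deriv e b v\<bar> \<le> N\<^sup>2 + N\<^sup>2 + N\<^sup>2 + 4 * N\<^sup>2"
    unfolding split by (rule sum_le[OF 1 2 3 4])
  thus ?thesis by (simp add: v_def N_def)
qed

lemma tilt_deriv_near: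
  assumes e: "norm e = 1"
  shows "\<bar>tilt_deriv e a (a - b) - tilt_deriv e b (a - b)\<bar> \<le> 7 * (norm (a - b))\<^sup>2"
proof (cases "norm b \<le> norm a")
  case True
  thus ?thesis by (rule tilt_deriv_near_ordered[OF e])
next
  case False
  have "tilt_deriv e c (a - b) = - tilt_deriv e c (b - a)" for c
    by (simp add: tilt_deriv_def inner_diff_left inner_diff_right algebra_simps diff_divide_distrib)
  thus ?thesis using tilt_deriv_near_ordered[OF e, of a b] False by (simp add: norm_minus_commute abs_minus_commute)
qed

section \<open>From derivatives to the defect of convexity\<close>

text \<open>
  The mean value theorem on both parts of the segment turns the defect into
  \<open>l * (1 - l) * (D p - D q) (x - y)\<close> for two points \<open>p\<close>, \<open>q\<close> of the segment. The vector \<open>p - q\<close> is a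
  positive multiple of \<open>x - y\<close>, and therefore a bound for the variation of the derivative tested
  on \<open>a - b\<close> alone is enough.
\<close>

lemma convexity_defect_le:
  fixes F :: "'a::real_normed_vector \<Rightarrow> real"
  assumes H: "convex H" and D: "\<And>x. x \<in> H \<Longrightarrow> (F has_derivative D x) (at x)"
    and mono: "mono_on {0..} \<mu>"
    and bd: "\<And>a b. a \<in> H \<Longrightarrow> b \<in> H \<Longrightarrow> \<bar>D a (a - b) - D b (a - b)\<bar> \<le> norm (a - b) * \<mu> (norm (a - b))"
    and x: "x \<in> H" and y: "y \<in> H" and l: "0 \<le> l" "l \<le> 1"
  shows "\<bar>l * F x + (1 - l) * F y - F (l *\<^sub>R x + (1 - l) *\<^sub>R y)\<bar>
           \<le> l * (1 - l) * norm (x - y) * \<mu> (norm (x - y))"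
proof (cases "l = 0 \<or> l = 1")
  case True thus ?thesis by auto
next
  case False
  hence l: "0 < l" "l < 1" using l by auto
  define v where "v = x - y"
  define p where "p s = y + s *\<^sub>R v" for s :: real
  have pH: "p s \<in> H" if "0 \<le> s" "s \<le> 1" for s
  proof -
    have "p s = (1 - s) *\<^sub>R y + s *\<^sub>R x" by (simp add: p_def v_def algebra_simps)
    thus ?thesis using convexD_alt[OF H y x that] by simp
  qed
  have der: "((\<lambda>s. F (p s)) has_real_derivative D (p s) v) (at s)" if s: "0 \<le> s" "s \<le> 1" for s
  proof -
    have p': "(p has_derivative (\<lambda>h. h *\<^sub>R v)) (at s)"
      unfolding p_def by (auto intro!: derivative_eq_intros)
    have "((\<lambda>s. F (p s)) has_derivative (\<lambda>h. D (p s) (h *\<^sub>R v))) (at s)"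
      by (rule has_derivative_compose[OF p' D[OF pH[OF s]]])
    moreover have "(\<lambda>h. D (p s) (h *\<^sub>R v)) = (*) (D (p s) v)"
      using linear_scale[OF has_derivative_linear[OF D[OF pH[OF s]]]] by (auto simp: fun_eq_iff)
    ultimately show ?thesis by (simp add: has_field_derivative_def)
  qed
  obtain s1 where s1: "l < s1" "s1 < 1" "F (p 1) - F (p l) = (1 - l) * D (p s1) v"
    using MVT2[of l 1 "\<lambda>s. F (p s)" "\<lambda>s. D (p s) v"] der l by auto
  obtain s0 where s0: "0 < s0" "s0 < l" "F (p l) - F (p 0) = (l - 0) * D (p s0) v"
    using MVT2[of 0 l "\<lambda>s. F (p s)" "\<lambda>s. D (p s) v"] der l by auto
  define c where "c = s1 - s0"
  have c: "0 < c" "c \<le> 1" using s1 s0 l by (auto simp: c_def)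
  have p01: "p 0 = y" "p 1 = x" by (simp_all add: p_def v_def)
  have pl: "p l = l *\<^sub>R x + (1 - l) *\<^sub>R y" by (simp add: p_def v_def algebra_simps)
  have in1: "p s1 \<in> H" "p s0 \<in> H" using pH s1 s0 l by auto
  have d: "p s1 - p s0 = c *\<^sub>R v" by (simp add: p_def c_def algebra_simps)
  have sc: "D (p s) (c *\<^sub>R v) = c * D (p s) v" if "p s \<in> H" for s
    using linear_scale[OF has_derivative_linear[OF D[OF that]]] by simp
  have "c * \<bar>D (p s1) v - D (p s0) v\<bar> = \<bar>D (p s1) (c *\<^sub>R v) - D (p s0) (c *\<^sub>R v)\<bar>"
    using c by (simp add: sc in1 right_diff_distrib[symmetric] abs_mult)
  also have "\<dots> \<le> c * (norm v * \<mu> (c * norm v))"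
    using bd[OF in1] c unfolding d by (simp add: mult.assoc)
  also have "\<dots> \<le> c * (norm v * \<mu> (norm v))"
    using c mono_onD[OF mono, of "c * norm v" "norm v"] mult_right_mono[of c 1 "norm v"]
    by (intro mult_left_mono) auto
  finally have "\<bar>D (p s1) v - D (p s0) v\<bar> \<le> norm v * \<mu> (norm v)" using c by simp
  moreover have "l * F x + (1 - l) * F y - F (p l) = l * (1 - l) * (D (p s1) v - D (p s0) v)"
  proof -
    have "l * F x + (1 - l) * F y - F (p l) = l * (F x - F (p l)) - (1 - l) * (F (p l) - F y)"
      by (simp add: algebra_simps)
    also have "\<dots> = l * ((1 - l) * D (p s1) v) - (1 - l) * (l * D (p s0) v)"
      using s1(3) s0(3) unfolding p01 by simp
    finally show ?thesis by (simp add: algebra_simps)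
  qed
  ultimately show ?thesis unfolding pl[symmetric] v_def[symmetric] using l
    by (simp add: abs_mult mult_left_mono mult.assoc)
qed

lemma tilt_convexity_defect:
  assumes e: "norm e = 1" and k: "k > 0" and H: "convex H"
    and flat: "\<And>x. x \<in> H \<Longrightarrow> \<bar>x \<bullet> e\<bar> \<le> (norm x + 1) / k"
    and x: "x \<in> H" "y \<in> H" and l: "0 \<le> l" "l \<le> 1"
  shows "\<bar>l * tilt e x + (1 - l) * tilt e y - tilt e (l *\<^sub>R x + (1 - l) *\<^sub>R y)\<bar>
           \<le> l * (1 - l) * norm (x - y) * (9 * min (norm (x - y)) (1 / k))"
proof (rule convexity_defect_le[OF H tilt_has_derivative _ _ x l])
  show "mono_on {0..} (\<lambda>r::real. 9 * min r (1 / k))" by (intro mono_onI) auto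
  fix a b assume ab: "a \<in> H" "b \<in> H"
  have "7 * (norm (a - b))\<^sup>2 \<le> norm (a - b) * (9 * norm (a - b))" by (simp add: power2_eq_square)
  thus "\<bar>tilt_deriv e a (a - b) - tilt_deriv e b (a - b)\<bar>
      \<le> norm (a - b) * (9 * min (norm (a - b)) (1 / k))"
    using tilt_deriv_far[OF k flat flat, OF ab refl] tilt_deriv_near[OF e, of a b]
    by (auto simp: min_def mult.commute)
qed

section \<open>Concave moduli and rescaling\<close>

lemma concave_modulus_scale:
  assumes m: "modulus \<omega>" and c: "concave_on {0..} \<omega>" and t: "0 \<le> t" "t \<le> 1" and r: "0 \<le> r"
  shows "t * \<omega> r \<le> \<omega> (t * r)"
proof -
  have "(1 - t) * \<omega> 0 + t * \<omega> r \<le> \<omega> ((1 - t) *\<^sub>R 0 + t *\<^sub>R r)"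
    by (rule concave_onD[OF c t]) (use r in auto)
  moreover have "0 \<le> (1 - t) * \<omega> 0" using m t by (simp add: modulus_def)
  ultimately show ?thesis by simp
qed

lemma concave_modulus_pos:
  assumes m: "modulus \<omega>" and c: "concave_on {0..} \<omega>" and nz: "\<exists>h\<ge>0. \<omega> h \<noteq> 0" and r: "0 < r"
  shows "0 < \<omega> r"
proof -
  have nn: "\<omega> h \<ge> 0" if "h \<ge> 0" for h using m that by (simp add: modulus_def)
  obtain h where h: "h \<ge> 0" "\<omega> h > 0" using nz nn by (metis less_eq_real_def)
  have "r / max r h * \<omega> (max r h) \<le> \<omega> (r / max r h * max r h)"
    by (rule concave_modulus_scale[OF m c]) (use r in auto)
  moreover have "\<omega> h \<le> \<omega> (max r h)"
    using m h r by (intro mono_onD[of "{0..}" \<omega>]) (auto simp: modulus_def)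
  ultimately show ?thesis using r h
    by (smt (verit) divide_pos_pos max.cobounded1 mult_pos_pos nonzero_divide_eq_eq)
qed

text \<open>
  With \<open>N = norm (x - y)\<close>, multiplying the rescaled bound \<open>min (N / h) (1 / k)\<close> by the amplitude
  gives \<open>\<omega> (h / k) * min (k * N / h) 1\<close>. This is at most \<open>\<omega> N\<close>: by concavity when \<open>N \<le> h / k\<close>, by monotonicity otherwise. The amplitude
  \<open>k * \<omega> (h / k)\<close> is chosen to make both cases work.
\<close>

lemma scaled_tilt_defect:
  assumes e: "norm e = 1" and k: "k > 0" and h: "h > 0" and G: "convex G"
    and flat: "\<And>x. x \<in> G \<Longrightarrow> \<bar>x \<bullet> e\<bar> \<le> (norm x + h) / k"
    and m: "modulus \<omega>" and c: "concave_on {0..} \<omega>"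
    and f: "\<And>x. f x = k * \<omega> (h / k) * ((x \<bullet> e) * saturation ((1 / h) *\<^sub>R x))"
    and xy: "x \<in> G" "y \<in> G" and l: "0 \<le> l" "l \<le> 1"
  shows "\<bar>l * f x + (1 - l) * f y - f (l *\<^sub>R x + (1 - l) *\<^sub>R y)\<bar>
           \<le> 9 * (l * (1 - l) * norm (x - y) * \<omega> (norm (x - y)))"
proof -
  define s where "s x = (1 / h) *\<^sub>R x" for x :: 'a
  define w where "w = \<omega> (h / k)"
  define N where "N = norm (x - y)"
  have w0: "w \<ge> 0" using m h k by (simp add: w_def modulus_def)
  have fs: "f x = k * w * h * tilt e (s x)" for x using h by (simp add: f tilt_def s_def w_def)
  have ss: "s (l *\<^sub>R x + (1 - l) *\<^sub>R y) = l *\<^sub>R s x + (1 - l) *\<^sub>R s y"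
    by (simp add: s_def scaleR_add_right mult.commute)
  have nd: "norm (s x - s y) = N / h" using h
    by (simp add: s_def N_def real_vector.scale_right_diff_distrib[symmetric])
  have flat': "\<bar>z \<bullet> e\<bar> \<le> (norm z + 1) / k" if z: "z \<in> s ` G" for z
  proof -
    obtain x where x: "x \<in> G" "z = s x" using z by auto
    have "\<bar>z \<bullet> e\<bar> = \<bar>x \<bullet> e\<bar> / h" using x h by (simp add: s_def abs_mult)
    also have "\<dots> \<le> (norm x + h) / k / h" using flat[OF x(1)] h by (intro divide_right_mono) auto
    also have "\<dots> = (norm z + 1) / k" using x h k by (simp add: s_def field_simps)
    finally show ?thesis .
  qed
  have conv: "convex (s ` G)" using convex_scaling[OF G, of "1 / h"] by (simp add: s_def image_def)
  have d: "\<bar>l * tilt e (s x) + (1 - l) * tilt e (s y) - tilt e (l *\<^sub>R s x + (1 - l) *\<^sub>R s y)\<bar>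
      \<le> l * (1 - l) * (N / h) * (9 * min (N / h) (1 / k))"
    using tilt_convexity_defect[OF e k conv flat' _ _ l, of "s x" "s y"] xy by (simp add: nd)
  have key: "w * min (k * (N / h)) 1 \<le> \<omega> N"
  proof (cases "N \<le> h / k")
    case True
    have t: "k * (N / h) \<le> 1" using True h k by (simp add: field_simps)
    have "k * (N / h) * w \<le> \<omega> (k * (N / h) * (h / k))" unfolding w_def
      by (rule concave_modulus_scale[OF m c]) (use t h k in \<open>auto simp: N_def\<close>)
    thus ?thesis using t h k by (simp add: mult.commute min_def)
  next
    case False
    have "w \<le> \<omega> N" unfolding w_def
      using m False h k by (intro mono_onD[of "{0..}" \<omega>]) (auto simp: modulus_def N_def)
    moreover have "w * min (k * (N / h)) 1 \<le> w * 1" using w0 by (intro mult_left_mono) auto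
    ultimately show ?thesis by simp
  qed
  have "\<bar>l * f x + (1 - l) * f y - f (l *\<^sub>R x + (1 - l) *\<^sub>R y)\<bar>
      = (k * w * h) * \<bar>l * tilt e (s x) + (1 - l) * tilt e (s y) - tilt e (l *\<^sub>R s x + (1 - l) *\<^sub>R s y)\<bar>"
  proof -
    have "l * f x + (1 - l) * f y - f (l *\<^sub>R x + (1 - l) *\<^sub>R y) = (k * w * h) *
       (l * tilt e (s x) + (1 - l) * tilt e (s y) - tilt e (l *\<^sub>R s x + (1 - l) *\<^sub>R s y))"
      unfolding fs ss by (simp add: algebra_simps)
    thus ?thesis using k w0 h by (simp add: abs_mult)
  qed
  also have "\<dots> \<le> (k * w * h) * (l * (1 - l) * (N / h) * (9 * min (N / h) (1 / k)))"
    using d k w0 h by (intro mult_left_mono) auto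
  also have "\<dots> = 9 * (l * (1 - l) * N * (w * (k * min (N / h) (1 / k))))" using h by simp
  also have "k * min (N / h) (1 / k) = min (k * (N / h)) 1" using k by (simp add: min_def field_simps)
  also have "9 * (l * (1 - l) * N * (w * min (k * (N / h)) 1)) \<le> 9 * (l * (1 - l) * N * \<omega> N)"
    using key l by (intro mult_left_mono) (auto simp: N_def)
  finally show ?thesis by (simp add: N_def)
qed

section \<open>Unbounded convex sets that contain no cone with interior\<close>

text \<open>
  By convexity the ray in the limit direction lies in the closure of \<open>G\<close>. It even lies in \<open>G\<close>: the point
  \<open>r *\<^sub>R u\<close> is the midpoint between the interior point \<open>0\<close> and the point \<open>(2 * r) *\<^sub>R u\<close> of the closure.
\<close>

lemma ray_subset_of_asymptotic_direction:
  fixes G :: "'a::euclidean_space set"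
  assumes G: "open G" "convex G" "0 \<in> G" and x: "\<And>i. x i \<in> G"
    and lim: "filterlim (\<lambda>i. norm (x i)) at_top sequentially"
    and u: "(\<lambda>i. x i /\<^sub>R norm (x i)) \<longlonglongrightarrow> u" and r: "0 \<le> r"
  shows "r *\<^sub>R u \<in> G"
proof -
  have "eventually (\<lambda>i. norm (x i) \<ge> max 1 (2 * r)) sequentially"
    using lim unfolding filterlim_at_top by blast
  then obtain N where N: "\<And>i. i \<ge> N \<Longrightarrow> norm (x i) \<ge> max 1 (2 * r)"
    by (auto simp: eventually_sequentially)
  have "(2 * r) *\<^sub>R u \<in> closure G"
  proof (rule closed_sequentially[OF closed_closure])
    show "(\<lambda>i. (2 * r) *\<^sub>R (x (i + N) /\<^sub>R norm (x (i + N)))) \<longlonglongrightarrow> (2 * r) *\<^sub>R u"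
      by (intro tendsto_intros LIMSEQ_ignore_initial_segment[OF u])
    fix i
    define t where "t = 2 * r / norm (x (i + N))"
    have "norm (x (i + N)) \<ge> max 1 (2 * r)" by (rule N) simp
    hence t: "0 \<le> t" "t \<le> 1" using r by (auto simp: t_def divide_le_eq_1)
    have "t *\<^sub>R x (i + N) \<in> G" using convexD_alt[OF G(2,3) x t] by simp
    thus "(2 * r) *\<^sub>R (x (i + N) /\<^sub>R norm (x (i + N))) \<in> closure G"
      using closure_subset[of G] by (auto simp: t_def divide_inverse)
  qed
  hence "open_segment 0 ((2 * r) *\<^sub>R u) \<subseteq> interior G"
    using G by (intro in_interior_closure_convex_segment) (auto simp: interior_open)
  moreover have "r *\<^sub>R u \<in> open_segment 0 ((2 * r) *\<^sub>R u)" if "r *\<^sub>R u \<noteq> 0"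
    using that by (auto simp: in_segment intro!: exI[of _ "1/2"])
  ultimately show ?thesis using G interior_subset[of G] by (cases "r *\<^sub>R u = 0") (auto simp del: scaleR_eq_0_iff)
qed

text \<open>
  The closed condition \<open>P\<close> on directions survives the passage to a limit on the compact sphere.
  It serves twice: with the trivial condition it yields a ray in \<open>G\<close>, and with a lower bound on the
  slope against \<open>e\<close> it yields a ray that contradicts the choice of \<open>e\<close>.
\<close>

lemma asymptotic_direction_exists:
  fixes G :: "'a::euclidean_space set"
  assumes G: "open G" "convex G" "0 \<in> G"
    and P: "closed {z. P z}" and x: "\<And>R. \<exists>x\<in>G. norm x \<ge> R \<and> P (x /\<^sub>R norm x)"
  obtains u where "norm u = 1" "P u" "\<And>r. 0 \<le> r \<Longrightarrow> r *\<^sub>R u \<in> G"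
proof -
  have "\<forall>i. \<exists>x\<in>G. norm x \<ge> real (Suc i) \<and> P (x /\<^sub>R norm x)" using x by blast
  then obtain X where X: "\<And>i. X i \<in> G" "\<And>i. norm (X i) \<ge> real (Suc i)" "\<And>i. P (X i /\<^sub>R norm (X i))"
    by metis
  have nz: "X i \<noteq> 0" for i using X(2)[of i] by auto
  have "\<forall>i. X i /\<^sub>R norm (X i) \<in> sphere 0 1" using nz by simp
  then obtain u \<rho> where u: "u \<in> sphere 0 1" "strict_mono (\<rho> :: nat \<Rightarrow> nat)"
      "((\<lambda>i. X i /\<^sub>R norm (X i)) \<circ> \<rho>) \<longlonglongrightarrow> u"
    using compact_sphere[of "0::'a" 1] unfolding compact_def by meson
  have lim: "filterlim (\<lambda>i. norm (X (\<rho> i))) at_top sequentially"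
  proof (rule filterlim_at_top_mono[OF filterlim_real_sequentially])
    have "real i \<le> norm (X (\<rho> i))" for i
      using X(2)[of "\<rho> i"] seq_suble[OF u(2), of i] by linarith
    thus "eventually (\<lambda>i. real i \<le> norm (X (\<rho> i))) sequentially" by simp
  qed
  have 1: "r *\<^sub>R u \<in> G" if "0 \<le> r" for r
    by (rule ray_subset_of_asymptotic_direction[OF G X(1) lim _ that])
      (use u(3) in \<open>simp add: o_def\<close>)
  have "u \<in> {z. P z}"
    by (rule closed_sequentially[OF P _ u(3)]) (use X(3) in auto)
  thus ?thesis using that[of u] 1 u(1) by auto
qed

lemma flat_direction:
  fixes G :: "'a::euclidean_space set"
  assumes G: "open G" "convex G" "0 \<in> G" "\<not> bounded G"
    and no_cone: "\<not> (\<exists>C a. pos_cone C \<and> interior C \<noteq> {} \<and> (\<lambda>x. a + x) ` C \<subseteq> G)"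
  obtains e d where "norm e = 1" "norm d = 1" "d \<bullet> e = 0" "\<And>r. 0 \<le> r \<Longrightarrow> r *\<^sub>R d \<in> G"
    "\<And>k. k > 0 \<Longrightarrow> \<exists>R. \<forall>x\<in>G. norm x \<ge> R \<longrightarrow> \<bar>x \<bullet> e\<bar> \<le> norm x / k"
proof -
  define K where "K = {u. \<forall>r\<ge>0. r *\<^sub>R u \<in> G}"
  have cone: "pos_cone K" by (auto simp: pos_cone_def K_def)
  have KG: "(\<lambda>x. 0 + x) ` K \<subseteq> G" unfolding K_def by (auto dest: spec[of _ 1])
  have iK: "interior K = {}" using no_cone cone KG by blast
  have cK: "convex K"
  proof (rule convexI)
    fix x y and s t :: real assume *: "x \<in> K" "y \<in> K" "0 \<le> s" "0 \<le> t" "s + t = 1"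
    have "s *\<^sub>R (r *\<^sub>R x) + t *\<^sub>R (r *\<^sub>R y) \<in> G" if "r \<ge> 0" for r
      using * that by (intro convexD[OF G(2)]) (auto simp: K_def)
    moreover have "r *\<^sub>R (s *\<^sub>R x + t *\<^sub>R y) = s *\<^sub>R (r *\<^sub>R x) + t *\<^sub>R (r *\<^sub>R y)" for r
      by (simp add: algebra_simps)
    ultimately show "s *\<^sub>R x + t *\<^sub>R y \<in> K" by (simp add: K_def)
  qed
  obtain a b where ab: "a \<noteq> 0" "K \<subseteq> {x. a \<bullet> x = b}"
    using empty_interior_subset_hyperplane[OF cK iK] .
  have "0 \<in> K" using G by (simp add: K_def)
  hence b: "b = 0" using ab by auto
  define e where "e = a /\<^sub>R norm a"
  have e: "norm e = 1" using ab by (simp add: e_def)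
  have Ke: "x \<bullet> e = 0" if "x \<in> K" for x
    using ab b that by (auto simp: e_def inner_commute)
  have "\<exists>x\<in>G. norm x \<ge> R \<and> True" for R :: real
    using G(4) unfolding bounded_iff by (meson linorder_le_cases)
  then obtain d where d: "norm d = 1" "\<And>r. 0 \<le> r \<Longrightarrow> r *\<^sub>R d \<in> G"
    using asymptotic_direction_exists[OF G(1-3), of "\<lambda>_. True"] by auto
  have de: "d \<bullet> e = 0" using d by (intro Ke) (simp add: K_def)
  have fl: "\<exists>R. \<forall>x\<in>G. norm x \<ge> R \<longrightarrow> \<bar>x \<bullet> e\<bar> \<le> norm x / k" if k: "k > 0" for k :: real
  proof (rule ccontr)
    assume neg: "\<not> ?thesis"
    have cl: "closed {z. 1 / k \<le> \<bar>z \<bullet> e\<bar>}" by (intro closed_Collect_le continuous_intros)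
    have "\<exists>x\<in>G. norm x \<ge> R \<and> 1 / k \<le> \<bar>(x /\<^sub>R norm x) \<bullet> e\<bar>" for R
    proof -
      obtain x where x: "x \<in> G" "norm x \<ge> R" "norm x / k < \<bar>x \<bullet> e\<bar>" using neg by (metis not_le)
      hence "x \<noteq> 0" by auto
      hence "1 / k \<le> \<bar>(x /\<^sub>R norm x) \<bullet> e\<bar>" using x(3) k by (simp add: abs_mult field_simps)
      thus ?thesis using x by blast
    qed
    then obtain u where u: "1 / k \<le> \<bar>u \<bullet> e\<bar>" "\<And>r. 0 \<le> r \<Longrightarrow> r *\<^sub>R u \<in> G"
      using asymptotic_direction_exists[OF G(1-3) cl] by metis
    have "u \<bullet> e = 0" using u by (intro Ke) (simp add: K_def)
    thus False using u(1) k by simp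
  qed
  show ?thesis by (rule that[OF e d(1) de d(2) fl])
qed

section \<open>Scales at which the modulus is far from linear\<close>

lemma good_scales:
  assumes inf: "(INF k\<in>{1::nat..}. Liminf at_top
            (\<lambda>h::real. ereal (\<omega> h / (real k * \<omega> (h / real k))))) = 0"
    and pos: "\<And>r. 0 < r \<Longrightarrow> 0 < \<omega> r" and \<epsilon>: "0 < \<epsilon>"
  obtains k :: nat where "1 \<le> k" "\<And>R. \<exists>h\<ge>R. \<omega> h \<le> \<epsilon> * (real k * \<omega> (h / real k))"
proof -
  have "(INF k\<in>{1::nat..}. Liminf at_top
            (\<lambda>h::real. ereal (\<omega> h / (real k * \<omega> (h / real k))))) < ereal \<epsilon>"
    using \<epsilon> unfolding inf by simp
  then obtain k :: nat where k: "1 \<le> k"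
    "Liminf at_top (\<lambda>h::real. ereal (\<omega> h / (real k * \<omega> (h / real k)))) < ereal \<epsilon>"
    by (auto simp: INF_less_iff)
  have "\<exists>h\<ge>R. \<omega> h \<le> \<epsilon> * (real k * \<omega> (h / real k))" for R
  proof (rule ccontr)
    assume neg: "\<not> ?thesis"
    have "ereal \<epsilon> \<le> ereal (\<omega> h / (real k * \<omega> (h / real k)))" if "h \<ge> max R 1" for h
    proof -
      have "0 < \<omega> (h / real k)" using that k by (intro pos) auto
      moreover have "\<epsilon> * (real k * \<omega> (h / real k)) < \<omega> h" using neg that
        by (metis max.boundedE not_le)
      ultimately show ?thesis using k by (simp add: pos_le_divide_eq)
    qed
    hence "eventually (\<lambda>h. ereal \<epsilon> \<le> ereal (\<omega> h / (real k * \<omega> (h / real k)))) at_top"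
      unfolding eventually_at_top_linorder by blast
    from Liminf_bounded[OF this] k(2) show False by simp
  qed
  thus ?thesis using that k by blast
qed

section \<open>The function\<close>

text \<open>
  The second property is stated with limits of difference quotients that are merely assumed to exist.
  At a point \<open>u\<close> of the hyperplane orthogonal to \<open>e\<close> the quotient is the value of the weight
  \<open>\<Sum>j. g j\<close> at \<open>u + t *\<^sub>R e\<close>, so the failure of the Lipschitz estimate can be read off from monotonicity,
  without differentiating an infinite series.
\<close>

lemma steep_flat_function:
  fixes G :: "'a::euclidean_space set"
  assumes G: "convex G" and e: "norm e = 1" and d: "norm d = 1" "d \<bullet> e = 0"
    and ray: "\<And>r. 0 \<le> r \<Longrightarrow> r *\<^sub>R d \<in> G"
    and flat: "\<And>k. k > 0 \<Longrightarrow> \<exists>R. \<forall>x\<in>G. norm x \<ge> R \<longrightarrow> \<bar>x \<bullet> e\<bar> \<le> norm x / k"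
    and m: "modulus \<omega>" and c: "concave_on {0..} \<omega>" and pos: "\<And>r. 0 < r \<Longrightarrow> 0 < \<omega> r"
    and inf: "(INF k\<in>{1::nat..}. Liminf at_top
            (\<lambda>h::real. ereal (\<omega> h / (real k * \<omega> (h / real k))))) = 0"
  obtains f :: "'a \<Rightarrow> real" where
    "\<And>x y l. \<lbrakk>x \<in> G; y \<in> G; 0 \<le> l; l \<le> 1\<rbrakk> \<Longrightarrow>
       \<bar>l * f x + (1 - l) * f y - f (l *\<^sub>R x + (1 - l) *\<^sub>R y)\<bar>
         \<le> l * (1 - l) * norm (x - y) * \<omega> (norm (x - y))"
    "\<And>C. \<exists>p\<in>G. \<exists>q\<in>G. \<forall>A B.
       ((\<lambda>t. (f (p + t *\<^sub>R e) - f p) / t) \<longlongrightarrow> A) (at 0) \<longrightarrow>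
       ((\<lambda>t. (f (q + t *\<^sub>R e) - f q) / t) \<longlongrightarrow> B) (at 0) \<longrightarrow>
       A - B > C * \<omega> (norm (p - q))"
proof -
  \<comment> \<open>The factor \<open>(1/4)^j\<close> beats the weight \<open>(1/2)^j\<close> of the \<open>j\<close>-th block in the sum.\<close>
  have "\<forall>j. \<exists>k h. 1 \<le> k \<and> k \<le> h \<and> \<omega> h \<le> (1/4)^j * (k * \<omega> (h / k))
      \<and> (\<forall>x\<in>G. \<bar>x \<bullet> e\<bar> \<le> (norm x + h) / k)"
  proof
    fix j :: nat
    have "(0::real) < (1/4)^j" by simp
    then obtain n :: nat where n: "1 \<le> n" "\<And>R. \<exists>h\<ge>R. \<omega> h \<le> (1/4)^j * (real n * \<omega> (h / real n))"
      using good_scales[OF inf pos] by blast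
    define k where "k = real n"
    have k: "k \<ge> 1" using n by (simp add: k_def)
    obtain R where R: "\<forall>x\<in>G. norm x \<ge> R \<longrightarrow> \<bar>x \<bullet> e\<bar> \<le> norm x / k" using flat[of k] k by auto
    obtain h where h: "h \<ge> max k (k * R)" "\<omega> h \<le> (1/4)^j * (k * \<omega> (h / k))"
      using n(2) unfolding k_def by blast
    have "\<bar>x \<bullet> e\<bar> \<le> (norm x + h) / k" if x: "x \<in> G" for x
    proof (cases "norm x \<ge> R")
      case True
      hence "\<bar>x \<bullet> e\<bar> \<le> norm x / k" using R x by blast
      also have "\<dots> \<le> (norm x + h) / k" using h k by (intro divide_right_mono) auto
      finally show ?thesis .
    next
      case False
      have "\<bar>x \<bullet> e\<bar> \<le> norm x" using Cauchy_Schwarz_ineq2[of x e] e by simp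
      also have "\<dots> \<le> R" using False by simp
      also have "\<dots> \<le> h / k" using h k by (simp add: pos_le_divide_eq mult.commute)
      also have "\<dots> \<le> (norm x + h) / k" using k by (intro divide_right_mono) auto
      finally show ?thesis .
    qed
    thus "\<exists>k h. 1 \<le> k \<and> k \<le> h \<and> \<omega> h \<le> (1/4)^j * (k * \<omega> (h / k))
      \<and> (\<forall>x\<in>G. \<bar>x \<bullet> e\<bar> \<le> (norm x + h) / k)" using k h by (intro exI[of _ k] exI[of _ h]) auto
  qed
  then obtain k h :: "nat \<Rightarrow> real" where k: "\<And>j. 1 \<le> k j" and kh: "\<And>j. k j \<le> h j"
    and gap: "\<And>j. \<omega> (h j) \<le> (1/4)^j * (k j * \<omega> (h j / k j))"
    and fl: "\<And>j x. x \<in> G \<Longrightarrow> \<bar>x \<bullet> e\<bar> \<le> (norm x + h j) / k j" by metis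
  have k0: "0 < k j" for j using k[of j] by linarith
  have h1: "1 \<le> h j" for j using k[of j] kh[of j] by linarith
  have h0: "0 < h j" for j using h1[of j] by linarith
  define w where "w j = k j * \<omega> (h j / k j)" for j
  have w0: "0 < w j" for j unfolding w_def using k0[of j] h0[of j] by (intro mult_pos_pos pos) auto
  \<comment> \<open>The amplitude grows at most like \<open>h j\<close>, while \<open>saturation\<close> contributes \<open>1 / (h j)\<^sup>2\<close>:
    this makes the series converge at every point.\<close>
  have w_le: "w j \<le> h j * \<omega> 1" for j
  proof -
    have "k j / h j * \<omega> (h j / k j) \<le> \<omega> (k j / h j * (h j / k j))"
      by (rule concave_modulus_scale[OF m c]) (use k0[of j] h0[of j] kh[of j] in auto)
    thus ?thesis using k0[of j] h0[of j] by (simp add: w_def field_simps)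
  qed
  \<comment> \<open>The divisor is \<open>18 = 9 * 2\<close>: the constant of \<open>scaled_tilt_defect\<close> times the sum of the \<open>(1/2)^j\<close>.\<close>
  define g where "g j y = (1/2)^j / 18 * w j * saturation ((1 / h j) *\<^sub>R y)" for j and y :: 'a
  define f where "f x = (x \<bullet> e) * (\<Sum>j. g j x)" for x
  have g0: "0 \<le> g j y" for j y
    unfolding g_def using less_imp_le[OF w0[of j]] saturation_nonneg by (intro mult_nonneg_nonneg) auto
  have g_le: "g j y \<le> (1/2)^j * (\<omega> 1 * (norm y)\<^sup>2)" for j y
  proof -
    have "w j * saturation ((1 / h j) *\<^sub>R y) \<le> (h j * \<omega> 1) * (norm ((1 / h j) *\<^sub>R y))\<^sup>2"
      using w_le[of j] saturation_le[of "(1 / h j) *\<^sub>R y"] h0[of j] pos[of 1] saturation_nonneg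
      by (intro mult_mono) auto
    also have "\<dots> = \<omega> 1 * (norm y)\<^sup>2 / h j" using h0[of j] by (simp add: power2_eq_square)
    also have "\<dots> \<le> \<omega> 1 * (norm y)\<^sup>2 / 1" using h1[of j] pos[of 1] by (intro divide_left_mono) auto
    finally have *: "w j * saturation ((1 / h j) *\<^sub>R y) \<le> \<omega> 1 * (norm y)\<^sup>2" by simp
    have "g j y = (1/2)^j / 18 * (w j * saturation ((1 / h j) *\<^sub>R y))" by (simp add: g_def)
    also have "\<dots> \<le> (1/2)^j / 1 * (\<omega> 1 * (norm y)\<^sup>2)"
      by (rule mult_mono[OF _ *])
        (use w0[of j] saturation_nonneg[of "(1 / h j) *\<^sub>R y"] in auto)
    finally show ?thesis by simp
  qed
  have sg: "summable (\<lambda>j. g j y)" for y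
  proof (rule summable_comparison_test)
    show "summable (\<lambda>j. (1/2)^j * (\<omega> 1 * (norm y)\<^sup>2))"
      by (intro summable_mult2 summable_geometric) simp
    show "\<exists>N. \<forall>n\<ge>N. norm (g n y) \<le> (1/2)^n * (\<omega> 1 * (norm y)\<^sup>2)" using g0 g_le by auto
  qed
  show ?thesis
  proof
    fix x y :: 'a and l :: real assume xy: "x \<in> G" "y \<in> G" and l: "0 \<le> l" "l \<le> 1"
    define z where "z = l *\<^sub>R x + (1 - l) *\<^sub>R y"
    define X where "X = l * (1 - l) * norm (x - y) * \<omega> (norm (x - y))"
    define \<Delta> where "\<Delta> j = l * ((x \<bullet> e) * g j x) + (1 - l) * ((y \<bullet> e) * g j y) - (z \<bullet> e) * g j z" for j
    have fs: "(\<lambda>j. (u \<bullet> e) * g j u) sums f u" for u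
      unfolding f_def by (intro sums_mult summable_sums sg)
    have "\<Delta> sums (l * f x + (1 - l) * f y - f z)"
      unfolding \<Delta>_def by (intro sums_diff sums_add sums_mult[OF fs] fs)
    hence eq: "l * f x + (1 - l) * f y - f z = suminf \<Delta>" by (simp add: sums_iff)
    have bound: "norm (\<Delta> j) \<le> (1/2)^j * (X / 2)" for j
    proof -
      let ?F = "\<lambda>x. k j * \<omega> (h j / k j) * ((x \<bullet> e) * saturation ((1 / h j) *\<^sub>R x))"
      have "\<bar>l * ?F x + (1 - l) * ?F y - ?F z\<bar> \<le> 9 * X" unfolding X_def z_def
        by (rule scaled_tilt_defect[OF e k0 h0 G fl m c _ xy l]) auto
      moreover have "\<Delta> j = (1/2)^j / 18 * (l * ?F x + (1 - l) * ?F y - ?F z)"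
        unfolding \<Delta>_def g_def w_def by (simp only: algebra_simps mult_1_left)
      ultimately have "\<bar>\<Delta> j\<bar> \<le> (1/2)^j / 18 * (9 * X)"
        by (simp only: abs_mult) (auto intro!: mult_mono)
      thus ?thesis by (simp add: mult.commute)
    qed
    have geo: "(\<lambda>j. (1/2)^j * (X / 2)) sums X"
      using sums_mult2[OF geometric_sums[of "1/2::real"], of "X / 2"] by simp
    have "norm (suminf \<Delta>) \<le> (\<Sum>j. (1/2)^j * (X / 2))"
      by (rule norm_suminf_le[OF bound sums_summable[OF geo]])
    thus "\<bar>l * f x + (1 - l) * f y - f (l *\<^sub>R x + (1 - l) *\<^sub>R y)\<bar>
         \<le> l * (1 - l) * norm (x - y) * \<omega> (norm (x - y))"
      unfolding z_def[symmetric] X_def[symmetric] eq using sums_unique[OF geo] by simp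
  next
    fix C :: real
    \<comment> \<open>The \<open>j\<close>-th block alone contributes \<open>w j / (36 * 2^j)\<close>, and \<open>\<omega> (h j) \<le> w j / 4^j\<close>.\<close>
    obtain j :: nat where j: "36 * C < 2 ^ j" using real_arch_pow[of 2 "36 * C"] by auto
    define p where "p = h j *\<^sub>R d"
    have pG: "p \<in> G" unfolding p_def by (rule ray) (use h0[of j] in simp)
    have zG: "0 \<in> G" using ray[of 0] by simp
    have pe: "p \<bullet> e = 0" using d by (simp add: p_def)
    have np: "norm p = h j" using d h0[of j] by (simp add: p_def)
    have ee: "e \<bullet> e = 1" using e by (simp add: dot_square_norm)
    have quot: "((\<lambda>t. (f (u + t *\<^sub>R e) - f u) / t) \<longlongrightarrow> A) (at 0)
        \<longleftrightarrow> ((\<lambda>t. \<Sum>j. g j (u + t *\<^sub>R e)) \<longlongrightarrow> A) (at 0)" if "u \<bullet> e = 0" for u A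
      by (rule filterlim_cong[OF refl refl])
        (auto simp: eventually_at_filter f_def that inner_add_left ee)
    have "A - B > C * \<omega> (norm (p - 0))"
      if A: "((\<lambda>t. (f (p + t *\<^sub>R e) - f p) / t) \<longlongrightarrow> A) (at 0)"
        and B: "((\<lambda>t. (f (0 + t *\<^sub>R e) - f 0) / t) \<longlongrightarrow> B) (at 0)" for A B
    proof -
      have 1: "((\<lambda>t. (\<Sum>j. g j (p + t *\<^sub>R e)) - (\<Sum>j. g j (0 + t *\<^sub>R e))) \<longlongrightarrow> A - B) (at 0)"
        using A B quot[OF pe] quot[of 0] by (intro tendsto_diff) auto
      have gj: "((\<lambda>t. g j (u + t *\<^sub>R e)) \<longlongrightarrow> g j u) (at 0)" for u
      proof -
        have "1 + (1 / h j) *\<^sub>R (u + 0 *\<^sub>R e) \<bullet> (1 / h j) *\<^sub>R (u + 0 *\<^sub>R e) \<noteq> 0"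
          using inner_ge_zero[of "(1 / h j) *\<^sub>R (u + 0 *\<^sub>R e)"] by linarith
        hence "((\<lambda>t. g j (u + t *\<^sub>R e)) \<longlongrightarrow> g j (u + 0 *\<^sub>R e)) (at 0)"
          unfolding g_def saturation_def by (intro tendsto_intros)
        thus ?thesis by simp
      qed
      have 2: "((\<lambda>t. g j (p + t *\<^sub>R e) - g j (0 + t *\<^sub>R e)) \<longlongrightarrow> g j p - g j 0) (at 0)"
        by (intro tendsto_diff gj)
      \<comment> \<open>\<open>p + t *\<^sub>R e\<close> is farther from the origin than \<open>t *\<^sub>R e\<close>, so every block of the
        difference is nonnegative and may be dropped.\<close>
      have mono: "g j (p + t *\<^sub>R e) - g j (0 + t *\<^sub>R e)
          \<le> (\<Sum>j. g j (p + t *\<^sub>R e)) - (\<Sum>j. g j (0 + t *\<^sub>R e))" for t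
      proof -
        have n: "norm (t *\<^sub>R e) \<le> norm (p + t *\<^sub>R e)"
          unfolding norm_le using pe by (simp add: inner_add_left inner_add_right inner_commute)
        have "0 \<le> g i (p + t *\<^sub>R e) - g i (0 + t *\<^sub>R e)" for i
        proof -
          have "saturation ((1 / h i) *\<^sub>R (t *\<^sub>R e)) \<le> saturation ((1 / h i) *\<^sub>R (p + t *\<^sub>R e))"
            using n h0[of i] unfolding norm_scaleR
            by (intro saturation_mono) (auto simp del: scaleR_scaleR simp: norm_scaleR[of "1 / h i"] divide_right_mono)
          thus ?thesis using w0[of i] by (simp add: g_def del: scaleR_scaleR)
        qed
        hence "(\<Sum>i\<in>{j}. g i (p + t *\<^sub>R e) - g i (0 + t *\<^sub>R e))
            \<le> (\<Sum>i. g i (p + t *\<^sub>R e) - g i (0 + t *\<^sub>R e))"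
          by (intro sum_le_suminf summable_diff sg) auto
        thus ?thesis using suminf_diff[OF sg[of "p + t *\<^sub>R e"] sg[of "0 + t *\<^sub>R e"]] by simp
      qed
      have "g j p - g j 0 \<le> A - B"
        by (rule tendsto_le[OF _ 1 2]) (use mono in auto)
      moreover have "g j p - g j 0 = (1/2)^j / 36 * w j"
      proof -
        have "(1 / h j) *\<^sub>R p = d" using h0[of j] by (simp add: p_def)
        moreover have "d \<bullet> d = 1" using d by (simp add: dot_square_norm)
        ultimately show ?thesis by (simp add: g_def saturation_def)
      qed
      moreover have "C * \<omega> (h j) < (1/2)^j / 36 * w j"
      proof (cases "C \<le> 0")
        case True
        have "C * \<omega> (h j) \<le> 0" using True pos[OF h0[of j]] by (simp add: mult_le_0_iff)
        also have "0 < (1/2)^j / 36 * w j" using w0[of j] by simp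
        finally show ?thesis .
      next
        case False
        hence "C * \<omega> (h j) \<le> C * ((1/4)^j * w j)" using gap[of j] by (simp add: w_def)
        also have "\<dots> < 2^j / 36 * ((1/4)^j * w j)"
          using j w0[of j] by (intro mult_strict_right_mono) auto
        also have "\<dots> = (1/2)^j / 36 * w j"
        proof -
          have "(2::real)^j * (1/4)^j = (1/2)^j" by (simp add: power_mult_distrib[symmetric])
          thus ?thesis by (metis (no_types, lifting) mult.assoc times_divide_eq_left)
        qed
        finally show ?thesis .
      qed
      ultimately show ?thesis by (simp add: np)
    qed
    thus "\<exists>p\<in>G. \<exists>q\<in>G. \<forall>A B.
       ((\<lambda>t. (f (p + t *\<^sub>R e) - f p) / t) \<longlongrightarrow> A) (at 0) \<longrightarrow>
       ((\<lambda>t. (f (q + t *\<^sub>R e) - f q) / t) \<longlongrightarrow> B) (at 0) \<longrightarrow>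
       A - B > C * \<omega> (norm (p - q))" using pG zG by blast
  qed
qed

lemma C1_modulus_quotients:
  assumes "f \<in> C1_modulus G \<omega>" and e: "norm (e::'a::euclidean_space) = 1"
  obtains D C where "\<And>x. x \<in> G \<Longrightarrow> ((\<lambda>t. (f (x + t *\<^sub>R e) - f x) / t) \<longlongrightarrow> D x) (at 0)"
    "\<And>x y. x \<in> G \<Longrightarrow> y \<in> G \<Longrightarrow> D x - D y \<le> C * \<omega> (norm (x - y))"
proof -
  obtain C where diff: "\<And>x. x \<in> G \<Longrightarrow> (f has_derivative frechet_derivative f (at x)) (at x)"
    and C: "\<And>x y. x \<in> G \<Longrightarrow> y \<in> G \<Longrightarrow>
      onorm (\<lambda>v. frechet_derivative f (at x) v - frechet_derivative f (at y) v) \<le> C * \<omega> (norm (x - y))"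
    using assms(1) by (auto simp: C1_modulus_def frechet_derivative_works)
  define D where "D x = frechet_derivative f (at x) e" for x
  have "((\<lambda>t. (f (x + t *\<^sub>R e) - f x) / t) \<longlongrightarrow> D x) (at 0)" if x: "x \<in> G" for x
  proof -
    have "((\<lambda>t. x + t *\<^sub>R e) has_derivative (\<lambda>t. t *\<^sub>R e)) (at 0)"
      by (auto intro!: derivative_eq_intros)
    hence "((\<lambda>t. f (x + t *\<^sub>R e)) has_derivative (\<lambda>t. frechet_derivative f (at x) (t *\<^sub>R e))) (at 0)"
      by (rule has_derivative_compose) (use diff[OF x] in simp)
    moreover have "(\<lambda>t. frechet_derivative f (at x) (t *\<^sub>R e)) = (*) (D x)"
      using linear_scale[OF has_derivative_linear[OF diff[OF x]]] by (auto simp: fun_eq_iff D_def)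
    ultimately have "DERIV (\<lambda>t. f (x + t *\<^sub>R e)) 0 :> D x" by (simp add: has_field_derivative_def)
    thus ?thesis by (simp add: DERIV_def)
  qed
  moreover have "D x - D y \<le> C * \<omega> (norm (x - y))" if x: "x \<in> G" "y \<in> G" for x y
  proof -
    have "bounded_linear (\<lambda>v. frechet_derivative f (at x) v - frechet_derivative f (at y) v)"
      by (intro bounded_linear_sub has_derivative_bounded_linear[OF diff] x)
    from onorm[OF this, of e] C[OF x] e show ?thesis by (simp add: D_def)
  qed
  ultimately show ?thesis using that by blast
qed

theorem theorem5p5:
  fixes G :: "(real ^ 'n) set" and \<omega> :: "real \<Rightarrow> real"
  assumes "CARD('n) \<ge> 2"
    and "open G" and "convex G" and "\<not> bounded G"
    and "\<not> (\<exists>C a. pos_cone C \<and> interior C \<noteq> {} \<and> (\<lambda>x. a + x) ` C \<subseteq> G)"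
    and "modulus \<omega>" and "concave_on {0..} \<omega>"
    and "\<exists>h\<ge>0. \<omega> h \<noteq> 0"
    and "(INF k\<in>{1::nat..}. Liminf at_top
            (\<lambda>h::real. ereal (\<omega> h / (real k * \<omega> (h / real k))))) = 0"
  shows "\<exists>f :: real ^ 'n \<Rightarrow> real.
           semiconvex_on G \<omega> f \<and> semiconcave_on G \<omega> f \<and> f \<notin> C1_modulus G \<omega>"
proof -
  obtain a where a: "a \<in> G" using assms(4) by fastforce
  define G0 where "G0 = (\<lambda>x. x - a) ` G"
  have mem: "x \<in> G0 \<longleftrightarrow> x + a \<in> G" for x by (force simp: G0_def)
  have G0: "open G0" "convex G0" "0 \<in> G0" "\<not> bounded G0"
    using assms(2-4) a bounded_translation[of G0 a]
    by (auto simp: mem G0_def open_translation_subtract convex_translation_subtract image_image)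
  have no_cone: "\<not> (\<exists>C b. pos_cone C \<and> interior C \<noteq> {} \<and> (\<lambda>x. b + x) ` C \<subseteq> G0)"
  proof
    assume "\<exists>C b. pos_cone C \<and> interior C \<noteq> {} \<and> (\<lambda>x. b + x) ` C \<subseteq> G0"
    then obtain C b where C: "pos_cone C" "interior C \<noteq> {}" "(\<lambda>x. b + x) ` C \<subseteq> G0" by blast
    have "(\<lambda>x. (a + b) + x) ` C \<subseteq> G"
      using C(3) by (auto simp: image_subset_iff mem algebra_simps)
    thus False using assms(5) C by blast
  qed
  have pos: "\<And>r. 0 < r \<Longrightarrow> 0 < \<omega> r" by (rule concave_modulus_pos[OF assms(6-8)])
  obtain e d where e: "norm e = 1" and d: "norm d = 1" "d \<bullet> e = 0" "\<And>r. 0 \<le> r \<Longrightarrow> r *\<^sub>R d \<in> G0"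
    and flat: "\<And>k. k > 0 \<Longrightarrow> \<exists>R. \<forall>x\<in>G0. norm x \<ge> R \<longrightarrow> \<bar>x \<bullet> e\<bar> \<le> norm x / k"
    using flat_direction[OF G0 no_cone] by metis
  obtain f where
    defect: "\<And>x y l. \<lbrakk>x \<in> G0; y \<in> G0; 0 \<le> l; l \<le> 1\<rbrakk> \<Longrightarrow>
       \<bar>l * f x + (1 - l) * f y - f (l *\<^sub>R x + (1 - l) *\<^sub>R y)\<bar>
         \<le> l * (1 - l) * norm (x - y) * \<omega> (norm (x - y))"
    and steep: "\<And>C. \<exists>p\<in>G0. \<exists>q\<in>G0. \<forall>A B.
       ((\<lambda>t. (f (p + t *\<^sub>R e) - f p) / t) \<longlongrightarrow> A) (at 0) \<longrightarrow>
       ((\<lambda>t. (f (q + t *\<^sub>R e) - f q) / t) \<longlongrightarrow> B) (at 0) \<longrightarrow>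
       A - B > C * \<omega> (norm (p - q))"
    using steep_flat_function[OF G0(2) e d flat assms(6,7) pos assms(9)] by blast
  define F where "F x = f (x - a)" for x
  have F: "\<bar>l * F x + (1 - l) * F y - F (l *\<^sub>R x + (1 - l) *\<^sub>R y)\<bar>
         \<le> l * (1 - l) * norm (x - y) * \<omega> (norm (x - y))"
    if "x \<in> G" "y \<in> G" "l \<in> {0..1}" for x y l
  proof -
    have "l *\<^sub>R (x - a) + (1 - l) *\<^sub>R (y - a) = l *\<^sub>R x + (1 - l) *\<^sub>R y - a"
      by (simp add: algebra_simps)
    thus ?thesis using defect[of "x - a" "y - a" l] that by (simp add: F_def mem)
  qed
  have "semiconvex_on G \<omega> F"
    unfolding semiconvex_on_def
  proof (intro ballI)
    fix x y and l :: real assume "x \<in> G" "y \<in> G" "l \<in> {0..1}"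
    from F[OF this] show "F (l *\<^sub>R x + (1 - l) *\<^sub>R y)
        \<le> l * F x + (1 - l) * F y + l * (1 - l) * norm (x - y) * \<omega> (norm (x - y))" by linarith
  qed
  moreover have "semiconcave_on G \<omega> F"
    unfolding semiconcave_on_def semiconvex_on_def
  proof (intro ballI)
    fix x y and l :: real assume "x \<in> G" "y \<in> G" "l \<in> {0..1}"
    from F[OF this] show "- F (l *\<^sub>R x + (1 - l) *\<^sub>R y)
        \<le> l * - F x + (1 - l) * - F y + l * (1 - l) * norm (x - y) * \<omega> (norm (x - y))" by simp
  qed
  moreover have "F \<notin> C1_modulus G \<omega>"
  proof
    assume F_C1: "F \<in> C1_modulus G \<omega>"
    obtain D C where
      quot: "\<And>x. x \<in> G \<Longrightarrow> ((\<lambda>t. (F (x + t *\<^sub>R e) - F x) / t) \<longlongrightarrow> D x) (at 0)"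
      and le: "\<And>x y. x \<in> G \<Longrightarrow> y \<in> G \<Longrightarrow> D x - D y \<le> C * \<omega> (norm (x - y))"
      by (rule C1_modulus_quotients[OF F_C1 e]) (rule that)
    obtain p q where pq: "p \<in> G0" "q \<in> G0" and s: "\<forall>A B.
       ((\<lambda>t. (f (p + t *\<^sub>R e) - f p) / t) \<longlongrightarrow> A) (at 0) \<longrightarrow>
       ((\<lambda>t. (f (q + t *\<^sub>R e) - f q) / t) \<longlongrightarrow> B) (at 0) \<longrightarrow>
       A - B > C * \<omega> (norm (p - q))"
      using steep[of C] by (elim bexE) (rule that)
    have q: "((\<lambda>t. (f (u + t *\<^sub>R e) - f u) / t) \<longlongrightarrow> D (u + a)) (at 0)" if "u \<in> G0" for u
      using quot[of "u + a"] that by (simp add: F_def mem)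
    have "D (p + a) - D (q + a) > C * \<omega> (norm (p - q))"
      using s q[OF pq(1)] q[OF pq(2)] by simp
    moreover have "D (p + a) - D (q + a) \<le> C * \<omega> (norm ((p + a) - (q + a)))"
      by (rule le) (use pq in \<open>simp_all add: mem\<close>)
    ultimately show False by simp
  qed
  ultimately show ?thesis by blast
qed

end
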